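(* Let $\lambda_n=\left|\dfrac{A_{n,n+1}}{A_{n-1,n}}\right|$ be the ratio of the areas of consecutive segments of the Binet-Fibonacci oscillating curve. Then $$\lim_{n\to\infty}\lambda_n=1.$$
   Context: Let $\varphi=\frac{1+\sqrt5}{2}$. The Binet-Fibonacci (oscillating) curve is the plane curve $t\mapsto (x(t),y(t))$, $t>0$, with $$x(t)=\frac{1}{\varphi+\varphi^{-1}}\left(e^{t\ln\varphi}-\cos(\pi t)e^{-t\ln\varphi}\right),\qquad y(t)=-\frac{1}{\varphi+\varphi^{-1}}\sin(\pi t)e^{-t\ln\varphi}.$$ For a positive integer $n$, the signed area of the segment between parameters $n$ and $n+1$ is (with the paper's sign convention) $$A_{n,n+1}=-\frac12\int_n^{n+1}\bigl(x\dot y-y\dot x\bigr)\,dt .$$ *)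

theory Defs
  imports "HOL-Analysis.Analysis"
begin

definition golden_ratio :: real where
  "golden_ratio = (1 + sqrt 5) / 2"

text \<open>
  The Binet-Fibonacci oscillating curve is considered for positive parameters; the functions
  below are given by the same formulas on all reals.
\<close>

definition binet_x :: "real \<Rightarrow> real" where
  "binet_x t = 1 / (golden_ratio + inverse golden_ratio) *
     (exp (t * ln golden_ratio) - cos (pi * t) * exp (- t * ln golden_ratio))"

definition binet_y :: "real \<Rightarrow> real" where
  "binet_y t = - 1 / (golden_ratio + inverse golden_ratio) *
     sin (pi * t) * exp (- t * ln golden_ratio)"

definition signed_area :: "real \<Rightarrow> real \<Rightarrow> real" where
  "signed_area a b =
     - 1 / 2 * integral {a..b} (\<lambda>t. binet_x t * deriv binet_y t - binet_y t * deriv binet_x t)"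

text \<open>
  For \<open>n = 0\<close> this refers to the parameter interval from \<open>-1\<close> to \<open>0\<close>, outside the curve; only
  positive \<open>n\<close> is meaningful, which does not affect the limit.
\<close>

definition area_ratio :: "nat \<Rightarrow> real" where
  "area_ratio n =
     \<bar>signed_area (real n) (real n + 1) / signed_area (real n - 1) (real n)\<bar>"

end

theory Submission
  imports Defs
begin

text \<open>
  With \<open>L = ln \<phi>\<close> and \<open>c = 1 / (\<phi> + \<phi>\<^sup>-\<^sup>1)\<close>, the mixed terms in \<open>x y' - y x'\<close> cancel and leave
  \<open>c\<^sup>2 (2 L sin (\<pi> t) - \<pi> cos (\<pi> t) + \<pi> e\<^bsup>-2 L t\<^esup>)\<close>. Over \<open>[n, n + 1]\<close> the sine contributes
  \<open>(-1)\<^sup>n 4 L / \<pi>\<close>, the cosine nothing, and the exponential tends to 0, so the absolute areas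
  converge to a nonzero constant.
\<close>

lemma ln_golden_ratio_pos: "ln golden_ratio > 0"
  unfolding golden_ratio_def by (intro ln_gt_zero) (simp add: real_less_rsqrt)

lemma golden_ratio_pos: "golden_ratio > 0"
  by (simp add: golden_ratio_def add_pos_pos)

text \<open>Since phi + 1/phi = sqrt 5, this is 1 / sqrt 5, the prefactor of the Binet
  formula.\<close>

definition binet_scale :: real where
  "binet_scale = 1 / (golden_ratio + inverse golden_ratio)"

lemma binet_scale_pos: "binet_scale > 0"
  using golden_ratio_pos by (simp add: binet_scale_def add_pos_pos)

lemma deriv_binet_x:
  "deriv binet_x t = binet_scale *
     (ln golden_ratio * exp (t * ln golden_ratio)
      + (pi * sin (pi * t) + ln golden_ratio * cos (pi * t)) * exp (- t * ln golden_ratio))"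
  unfolding binet_x_def [abs_def] binet_scale_def [symmetric]
  by (intro DERIV_imp_deriv) (auto intro!: derivative_eq_intros simp: algebra_simps)

lemma deriv_binet_y:
  "deriv binet_y t = - binet_scale *
     (pi * cos (pi * t) - ln golden_ratio * sin (pi * t)) * exp (- t * ln golden_ratio)"
proof -
  \<comment> \<open>The numerator -1 in \<open>binet_y\<close> hides the pattern of
    \<open>binet_scale\<close>, so the sign is moved out first.\<close>
  have eq: "binet_y = (\<lambda>t. - binet_scale * sin (pi * t) * exp (- t * ln golden_ratio))"
    by (simp add: fun_eq_iff binet_y_def binet_scale_def)
  show ?thesis
    unfolding eq
    by (intro DERIV_imp_deriv) (auto intro!: derivative_eq_intros simp: algebra_simps)
qed

lemma binet_area_density:
  "binet_x t * deriv binet_y t - binet_y t * deriv binet_x t =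
     binet_scale\<^sup>2 * (2 * ln golden_ratio * sin (pi * t) - pi * cos (pi * t)
       + pi * exp (- 2 * ln golden_ratio * t))"
proof -
  define E where "E = exp (t * ln golden_ratio)"
  define D where "D = exp (- t * ln golden_ratio)"
  define S where "S = sin (pi * t)"
  define C where "C = cos (pi * t)"
  have ED: "E * D = 1"
    by (simp add: E_def D_def flip: exp_add)
  have DD: "exp (- 2 * ln golden_ratio * t) = D\<^sup>2"
    by (simp add: D_def power2_eq_square flip: exp_add)
  have SC: "S\<^sup>2 + C\<^sup>2 = 1"
    by (simp add: S_def C_def)
  have x: "binet_x t = binet_scale * (E - C * D)"
    by (simp add: binet_x_def binet_scale_def E_def D_def C_def)
  have y: "binet_y t = - binet_scale * S * D"
    by (simp add: binet_y_def binet_scale_def D_def S_def)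
  \<comment> \<open>With \<open>E * D\<close> and \<open>S\<^sup>2 + C\<^sup>2\<close> left
    unevaluated, this is a pure polynomial identity; the \<open>S * C * D\<^sup>2\<close> terms
    cancel.\<close>
  have "binet_x t * deriv binet_y t - binet_y t * deriv binet_x t =
     binet_scale\<^sup>2 * ((2 * ln golden_ratio * S - pi * C) * (E * D) + pi * (S\<^sup>2 + C\<^sup>2) * D\<^sup>2)"
    unfolding x y deriv_binet_x deriv_binet_y
      E_def [symmetric] D_def [symmetric] S_def [symmetric] C_def [symmetric]
    by algebra
  then show ?thesis
    unfolding ED SC DD S_def C_def by simp
qed

lemma signed_area_eq:
  assumes "a \<le> b"
  shows "signed_area a b = - (binet_scale\<^sup>2 / 2) *
    (2 * ln golden_ratio / pi * (cos (pi * a) - cos (pi * b)) + (sin (pi * a) - sin (pi * b))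
     + pi / (2 * ln golden_ratio)
       * (exp (- 2 * ln golden_ratio * a) - exp (- 2 * ln golden_ratio * b)))"
proof -
  define L where "L = ln golden_ratio"
  have L: "L \<noteq> 0"
    using ln_golden_ratio_pos by (simp add: L_def)
  \<comment> \<open>A termwise antiderivative of the density; its last term divides by
    \<open>L\<close>, hence \<open>L \<noteq> 0\<close> above.\<close>
  define F where "F t = binet_scale\<^sup>2 *
    (- 2 * L / pi * cos (pi * t) - sin (pi * t) - pi / (2 * L) * exp (- 2 * L * t))" for t
  have "(F has_real_derivative
      binet_scale\<^sup>2 * (2 * L * sin (pi * t) - pi * cos (pi * t) + pi * exp (- 2 * L * t)))
      (at t within {a..b})" for t
    unfolding F_def [abs_def] using L
    by (auto intro!: derivative_eq_intros simp: algebra_simps)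
  then have "((\<lambda>t. binet_x t * deriv binet_y t - binet_y t * deriv binet_x t)
      has_integral (F b - F a)) {a..b}"
    unfolding binet_area_density L_def [symmetric]
    by (intro fundamental_theorem_of_calculus assms)
      (simp add: has_real_derivative_iff_has_vector_derivative)
  then have "signed_area a b = - 1 / 2 * (F b - F a)"
    unfolding signed_area_def by (simp only: integral_unique)
  then show ?thesis
    unfolding F_def L_def [symmetric] by (simp add: algebra_simps)
qed

text \<open>At integer endpoints the sines vanish and the cosines alternate, so the area is an
  alternating constant plus a geometrically decaying term. The absolute value removes the
  alternation.\<close>

lemma tendsto_abs_signed_area:
  "(\<lambda>n. \<bar>signed_area (real n) (real n + 1)\<bar>) \<longlonglongrightarrow> binet_scale\<^sup>2 / 2 * (4 * ln golden_ratio / pi)"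
proof -
  define L where "L = ln golden_ratio"
  have L: "L > 0"
    using ln_golden_ratio_pos by (simp add: L_def)
  \<comment> \<open>\<open>q\<close> is phi^(-2), the decay of the exponential part per unit of
    parameter; \<open>K\<close> is its contribution, up to the common factor, at n = 0.\<close>
  define q where "q = exp (- 2 * L)"
  define K where "K = pi / (2 * L) * (1 - q)"
  have expn: "exp (- 2 * L * real n) = q ^ n" for n
    by (simp add: q_def mult.commute flip: exp_of_nat_mult)
  have area: "\<bar>signed_area (real n) (real n + 1)\<bar> =
      binet_scale\<^sup>2 / 2 * \<bar>4 * L / pi + K * (- q) ^ n\<bar>" for n
  proof -
    have trig: "cos (pi * (real n + 1)) = - ((- 1) ^ n)" "sin (pi * (real n + 1)) = 0"
      "cos (pi * real n) = (- 1) ^ n" "sin (pi * real n) = 0"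
      by (simp_all add: distrib_left mult.commute [of pi])
    have sign: "(- 1) ^ n * ((- 1) ^ n * x) = x" for x :: real
      by (simp flip: mult.assoc power_mult_distrib)
    have expS: "exp (- 2 * L * (real n + 1)) = q ^ n * q"
      unfolding expn [symmetric] by (simp add: q_def algebra_simps flip: exp_add)
    have "signed_area (real n) (real n + 1) =
        - (binet_scale\<^sup>2 / 2) * (4 * L / pi * (- 1) ^ n + K * q ^ n)"
      unfolding signed_area_eq [OF less_imp_le [OF less_add_one]] L_def [symmetric] trig expn expS
      using L by (simp add: K_def field_simps)
    \<comment> \<open>Pulling out (-1)^n moves the alternation onto the vanishing term, as (-1)^n is
      its own inverse.\<close>
    also have "\<dots> = - (binet_scale\<^sup>2 / 2) * (- 1) ^ n * (4 * L / pi + K * (- q) ^ n)"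
      by (simp add: power_minus [of q] distrib_left mult.left_commute [of K] sign mult.assoc)
    finally show ?thesis
      by (simp add: abs_mult power_abs)
  qed
  have "norm (- q) < 1"
    using L by (simp add: q_def)
  then have "(\<lambda>n. binet_scale\<^sup>2 / 2 * \<bar>4 * L / pi + K * (- q) ^ n\<bar>)
      \<longlonglongrightarrow> binet_scale\<^sup>2 / 2 * \<bar>4 * L / pi + K * 0\<bar>"
    by (intro tendsto_intros)
  then show ?thesis
    using L by (simp add: area L_def)
qed

theorem mainTheorem3:
  shows "area_ratio \<longlonglongrightarrow> 1"
proof -
  let ?A = "\<lambda>n. \<bar>signed_area (real n) (real n + 1)\<bar>"
  let ?l = "binet_scale\<^sup>2 / 2 * (4 * ln golden_ratio / pi)"
  have "?l \<noteq> 0"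
    using binet_scale_pos ln_golden_ratio_pos by simp
  \<comment> \<open>Shifting the index turns the segment from n - 1 to n into \<open>?A n\<close>
    and skips the value at n = 0; the quotient rule needs the limit \<open>?l\<close> to be
    nonzero.\<close>
  then have "(\<lambda>n. ?A (Suc n) / ?A n) \<longlonglongrightarrow> ?l / ?l"
    by (intro tendsto_divide LIMSEQ_Suc tendsto_abs_signed_area)
  moreover have "area_ratio (Suc n) = ?A (Suc n) / ?A n" for n
    by (simp add: area_ratio_def abs_divide add.commute)
  ultimately have "(\<lambda>n. area_ratio (Suc n)) \<longlonglongrightarrow> 1"
    using \<open>?l \<noteq> 0\<close> by simp
  then show ?thesis
    by (rule LIMSEQ_imp_Suc)
qed

end
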